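(* For any $\epsilon > 0$, there exist a constant $c > 0$ and a distribution of instances of XOS maximization such that any randomized $n^{1-\epsilon}$-approximation algorithm calls the value oracle at least $\delta\cdot 2^{\Omega(n^c)}$ times with probability at least $1-\delta$ for any $0<\delta<1$. Moreover, there exists a distribution of instances of XOS maximization such that any randomized $o(n/\log n)$-approximation algorithm calls the value oracle at least $\delta\cdot n^{\omega(1)}$ times with probability at least $1-\delta$ for any $0<\delta<1$.
   Context: A set function $f\colon 2^V\to\mathbb{R}$ on a finite set $V$ is additive if $f(X)=\sum_{v\in X}f(\{v\})$ for all $X\subseteq V$. It is XOS if there are finitely many additive functions $f_1,\dots,f_k\colon 2^V\to\mathbb{R}$ (values may be negative) such that $f(X)=\max_{1\le i\le k}f_i(X)$ for all $X\subseteq V$. XOS maximization: given an XOS function $f$ on $V$, with $n=|V|$, accessible only through a value oracle (a query $X\subseteq V$ returns $f(X)$), find $X\subseteq V$ maximizing $f(X)$. For $\alpha\ge 1$, a randomized algorithm is an $\alpha$-approximation algorithm if the expected function value of its output is at least $\frac{1}{\alpha}\cdot\max_{X\subseteq V}f(X)$. $\log$ is the natural logarithm.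
   Formalization: The number of calls is taken as its expectation over the algorithm's coins, with probability over the random instance only; the joint reading is false: search exhaustively with probability 1/α, otherwise output the empty set with no calls. *)

theory Defs
  imports "HOL-Probability.Probability" "HOL-Library.Landau_Symbols"
begin

definition additive_on :: "'a set \<Rightarrow> ('a set \<Rightarrow> real) \<Rightarrow> bool" where
  "additive_on V g \<longleftrightarrow> (\<forall>X\<subseteq>V. g X = (\<Sum>v\<in>X. g {v}))"

definition xos_on :: "'a set \<Rightarrow> ('a set \<Rightarrow> real) \<Rightarrow> bool" where
  "xos_on V f \<longleftrightarrow> finite V \<and>
     (\<exists>F. finite F \<and> F \<noteq> {} \<and> (\<forall>g\<in>F. additive_on V g) \<and>
          (\<forall>X\<subseteq>V. f X = Max ((\<lambda>g. g X) ` F)))"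

text \<open>A randomized algorithm with access to a value oracle is a well-founded decision tree:
  it halts with an output, or submits a query and continues depending on the real number returned,
  or makes an internal random choice (with an arbitrary discrete distribution).  No bound on
  internal computation is imposed; only oracle calls are counted.  The set function
  \<open>mentioned\<close> collects every query and output that occurs anywhere in the tree.\<close>

datatype (mentioned: 'x) oracle_alg =
    Output 'x
  | Query 'x "real \<Rightarrow> 'x oracle_alg"
  | Choose "'x oracle_alg pmf"

text \<open>The joint distribution of the output and the number of oracle calls
  (repeated queries are counted repeatedly).\<close>

primrec run :: "('x \<Rightarrow> real) \<Rightarrow> 'x oracle_alg \<Rightarrow> ('x \<times> nat) pmf" where
  "run f (Output x) = return_pmf (x, 0)"
| "run f (Query x k) = map_pmf (map_prod id Suc) (run f (k (f x)))"
| "run f (Choose p) = join_pmf (map_pmf (run f) p)"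

definition expected_value :: "('x \<Rightarrow> real) \<Rightarrow> 'x oracle_alg \<Rightarrow> real" where
  "expected_value f A = measure_pmf.expectation (run f A) (\<lambda>(x, q). f x)"

text \<open>The number of oracle calls of a randomized algorithm on a fixed instance is its expectation
  over the internal randomness of the algorithm; it may be infinite, hence the type
  \<^typ>\<open>ennreal\<close>.  For an algorithm without random choices it is the actual number of calls.\<close>

definition oracle_calls :: "('x \<Rightarrow> real) \<Rightarrow> 'x oracle_alg \<Rightarrow> ennreal" where
  "oracle_calls f A = (\<integral>\<^sup>+ (x, q). of_nat q \<partial>measure_pmf (run f A))"

definition xos_approx_alg :: "'a set \<Rightarrow> real \<Rightarrow> 'a set oracle_alg \<Rightarrow> bool" where
  "xos_approx_alg V \<alpha> A \<longleftrightarrow> 1 \<le> \<alpha> \<and> mentioned A \<subseteq> Pow V \<and>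
     (\<forall>f. xos_on V f \<longrightarrow> expected_value f A \<ge> 1 / \<alpha> * Max (f ` Pow V))"

text \<open>A distribution of instances for every size \<open>n\<close>, on the ground set \<open>{..<n}\<close>.\<close>

definition xos_distribution :: "(nat \<Rightarrow> (nat set \<Rightarrow> real) pmf) \<Rightarrow> bool" where
  "xos_distribution D \<longleftrightarrow> (\<forall>n. \<forall>f\<in>set_pmf (D n). xos_on {..<n} f)"

text \<open>At least \<open>\<delta> * N\<close> oracle calls with probability at least \<open>1 - \<delta>\<close>, for every
  \<open>\<delta>\<close>, where the probability refers to the random instance.  (A joint probability over
  instance and coins would not do: answering \<open>{}\<close> without any query, except for an exhaustive
  search with probability \<open>1 / \<alpha>\<close>, is an \<open>\<alpha>\<close>-approximation algorithm.)\<close>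

definition many_calls :: "('x \<Rightarrow> real) pmf \<Rightarrow> 'x oracle_alg \<Rightarrow> real \<Rightarrow> bool" where
  "many_calls P A N \<longleftrightarrow> (\<forall>\<delta>. 0 < \<delta> \<and> \<delta> < 1 \<longrightarrow>
     measure_pmf.prob P {f. oracle_calls f A \<ge> ennreal (\<delta> * N)} \<ge> 1 - \<delta>)"

end

theory Submission
  imports Defs "HOL-Real_Asymp.Real_Asymp"
begin

text \<open>Fix a threshold \<open>t\<close> and let \<open>f0\<close> be the cardinality on sets of size at most \<open>t\<close> and \<open>0\<close>
  elsewhere, so its maximum is at most \<open>t\<close>.  Planting a random set \<open>S\<close>, containing each element with
  probability \<open>1 / b\<close>, raises the value of every subset of \<open>S\<close> to its cardinality and hence the maximum
  to about \<open>n / b\<close>; a query reveals the difference only if it lies in \<open>S\<close> and has more than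
  \<open>t\<close> elements, which happens with probability at most \<open>b ^ -(t + 1)\<close>.  An algorithm that guarantees
  a value above \<open>t\<close> on average over \<open>S\<close> must therefore make about \<open>b ^ (t + 1) / n\<close> queries already on
  \<open>f0\<close>.  So the instance distribution can be concentrated on \<open>f0\<close>, and the planted instances enter only
  through the guarantee of the algorithm; in particular \<open>b\<close> may depend on the
  approximation ratio.  For ratio \<open>n powr (1 - \<epsilon>)\<close> take \<open>t = n powr (\<epsilon> / 2)\<close> and \<open>b = 2\<close>; for ratio
  \<open>n / (K * ln n)\<close> with \<open>K\<close> tending to infinity take \<open>t = ln n\<close> and \<open>b = K\<close>, up to lower-order terms.\<close>

lemma ennreal_expectation_le:
  assumes "\<And>x. 0 \<le> f x"
  shows "ennreal (measure_pmf.expectation p f) \<le> (\<integral>\<^sup>+ x. ennreal (f x) \<partial>measure_pmf p)"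
proof (cases "integrable (measure_pmf p) f")
  case True
  then show ?thesis
    using assms by (simp add: nn_integral_eq_integral)
next
  case False
  then show ?thesis
    by (simp add: not_integrable_integral_eq)
qed

definition downset_card :: "'a set set \<Rightarrow> 'a set \<Rightarrow> real" where
  "downset_card T X = (if X \<in> T then real (card X) else 0)"

lemma downset_card_nonneg: "0 \<le> downset_card T X"
  by (simp add: downset_card_def)

text \<open>The additive function of a member \<open>Y\<close> of the down-set rewards the elements of \<open>Y\<close> and
  penalizes every other element so heavily that it is positive only on subsets of \<open>Y\<close>.\<close>

lemma xos_on_downset_card:
  fixes V :: "'a set"
  assumes V: "finite V" and TV: "T \<subseteq> Pow V"
    and down: "\<And>X Y. Y \<in> T \<Longrightarrow> X \<subseteq> Y \<Longrightarrow> X \<in> T"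
  shows "xos_on V (downset_card T)"
proof -
  define w :: "'a set \<Rightarrow> 'a \<Rightarrow> real"
    where "w Y v = (if v \<in> Y then 1 else - real (card V))" for Y v
  define g where "g Y X = (\<Sum>v\<in>X. w Y v)" for Y X
  define F where "F = insert (\<lambda>_. 0) (g ` T)"
  have finF: "finite F"
    using V TV by (auto simp: F_def intro: finite_subset)
  have le_card: "g Y X \<le> real (card X)" for Y X
    using sum_bounded_above[of X "w Y" 1] by (auto simp: g_def w_def)
  have nonpos: "g Y X \<le> 0" if "Y \<in> T" "X \<subseteq> V" "X \<notin> T" for X Y
  proof -
    obtain v where v: "v \<in> X" "v \<notin> Y"
      using down \<open>Y \<in> T\<close> \<open>X \<notin> T\<close> by blast
    have finX: "finite X"
      using V \<open>X \<subseteq> V\<close> finite_subset by blast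
    have "g Y X = w Y v + g Y (X - {v})"
      using finX v(1) by (simp add: g_def sum.remove)
    also have "\<dots> \<le> - real (card V) + real (card (X - {v}))"
      using v(2) le_card[of Y "X - {v}"] by (simp add: w_def)
    also have "\<dots> \<le> 0"
      using V \<open>X \<subseteq> V\<close> card_mono[of V "X - {v}"] by auto
    finally show ?thesis .
  qed
  have "additive_on V h" if "h \<in> F" for h
    using that by (auto simp: F_def additive_on_def g_def)
  moreover have "downset_card T X = Max ((\<lambda>h. h X) ` F)" if XV: "X \<subseteq> V" for X
  proof (rule sym, rule Max_eqI)
    show "finite ((\<lambda>h. h X) ` F)"
      using finF by simp
  next
    fix y assume "y \<in> (\<lambda>h. h X) ` F"
    then show "y \<le> downset_card T X"
      using le_card nonpos[OF _ XV] by (auto simp: F_def downset_card_def)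
  next
    have "g X X = real (card X)"
      by (simp add: g_def w_def)
    then show "downset_card T X \<in> (\<lambda>h. h X) ` F"
      by (cases "X \<in> T") (auto simp: F_def downset_card_def image_image intro: rev_image_eqI)
  qed
  ultimately show ?thesis
    using V finF by (auto simp: xos_on_def F_def intro!: exI[of _ F])
qed

lemma oracle_calls_simps:
  "oracle_calls f (Output x) = 0"
  "oracle_calls f (Query x k) = 1 + oracle_calls f (k (f x))"
  "oracle_calls f (Choose p) = (\<integral>\<^sup>+ A. oracle_calls f A \<partial>measure_pmf p)"
    apply (simp add: oracle_calls_def)
   apply (simp add: oracle_calls_def case_prod_unfold nn_integral_add)
  apply (simp add: oracle_calls_def case_prod_unfold join_eq_bind_pmf bind_map_pmf)
  done

definition nn_value :: "('x \<Rightarrow> real) \<Rightarrow> 'x oracle_alg \<Rightarrow> ennreal" where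
  "nn_value f A = (\<integral>\<^sup>+ r. ennreal (f (fst r)) \<partial>measure_pmf (run f A))"

lemma nn_value_simps:
  "nn_value f (Output x) = ennreal (f x)"
  "nn_value f (Query x k) = nn_value f (k (f x))"
  "nn_value f (Choose p) = (\<integral>\<^sup>+ A. nn_value f A \<partial>measure_pmf p)"
  by (simp_all add: nn_value_def join_eq_bind_pmf bind_map_pmf)

lemma expected_value_le_nn_value:
  assumes "\<And>x. 0 \<le> f x"
  shows "ennreal (expected_value f A) \<le> nn_value f A"
  using ennreal_expectation_le[of "\<lambda>r. f (fst r)" "run f A"] assms
  by (simp add: expected_value_def nn_value_def case_prod_unfold)

lemma nn_value_le:
  assumes "\<And>x. f x \<le> M"
  shows "nn_value f A \<le> ennreal M"
proof -
  have "nn_value f A \<le> (\<integral>\<^sup>+ r. ennreal M \<partial>measure_pmf (run f A))"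
    unfolding nn_value_def using assms by (intro nn_integral_mono ennreal_leI) auto
  then show ?thesis by simp
qed

text \<open>A run on \<open>f i\<close> follows the run on \<open>f0\<close> up to the first query that tells the two apart.
  Each query tells at most \<open>R\<close> instances apart from \<open>f0\<close>; for the induction these instances are
  dropped from \<open>J\<close>, at a cost of at most \<open>M * R\<close>.\<close>

lemma sum_nn_value_le:
  fixes f0 :: "'x \<Rightarrow> real" and f :: "'i \<Rightarrow> 'x \<Rightarrow> real"
  assumes I: "finite I" and f0: "\<And>x. f0 x \<le> t"
    and M: "\<And>i x. f i x \<le> M"
    and R: "\<And>x. real (card {i\<in>I. f i x \<noteq> f0 x}) \<le> R"
    and "0 \<le> t" "0 \<le> M" "J \<subseteq> I"
  shows "(\<Sum>i\<in>J. nn_value (f i) A)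
    \<le> ennreal (real (card J) * t) + ennreal (M * R) * (oracle_calls f0 A + 1)"
proof -
  have finite_sub: "finite J" if "J \<subseteq> I" for J
    using I that finite_subset by blast
  have split: "(\<Sum>i\<in>J. h i) = (\<Sum>i\<in>{i\<in>J. P i}. h i) + (\<Sum>i\<in>{i\<in>J. \<not> P i}. h i)"
    if "J \<subseteq> I" for J P and h :: "'i \<Rightarrow> ennreal"
    using finite_sub[OF that]
    by (subst sum.union_disjoint[symmetric]) (auto intro!: sum.cong)
  have told_apart: "(\<Sum>i\<in>{i\<in>J. f i x \<noteq> f0 x}. h i) \<le> ennreal (M * R)"
    if J: "J \<subseteq> I" and h: "\<And>i. h i \<le> ennreal M" for J x and h :: "'i \<Rightarrow> ennreal"
  proof -
    let ?D = "{i\<in>J. f i x \<noteq> f0 x}"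
    have "card ?D \<le> card {i\<in>I. f i x \<noteq> f0 x}"
      using I J by (intro card_mono) auto
    then have "real (card ?D) \<le> R"
      using R[of x] by linarith
    then have "real (card ?D) * M \<le> M * R"
      using \<open>0 \<le> M\<close> mult_left_mono[of "real (card ?D)" R M] by (simp add: mult.commute)
    moreover have "(\<Sum>i\<in>?D. h i) \<le> ennreal (real (card ?D) * M)"
      using sum_bounded_above[of ?D h "ennreal M"] h \<open>0 \<le> M\<close>
      by (simp add: ennreal_of_nat_eq_real_of_nat ennreal_mult)
    ultimately show ?thesis
      using ennreal_leI order_trans by blast
  qed
  have agreeing: "ennreal (real (card {i\<in>J. P i}) * t) \<le> ennreal (real (card J) * t)"
    if "J \<subseteq> I" for J P
    using finite_sub[OF that] \<open>0 \<le> t\<close>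
    by (intro ennreal_leI mult_right_mono) (auto intro!: card_mono)
  show ?thesis
    using \<open>J \<subseteq> I\<close>
  proof (induction A arbitrary: J)
    case (Output x)
    let ?E = "{i\<in>J. f i x = f0 x}"
    have "(\<Sum>i\<in>?E. ennreal (f i x)) \<le> of_nat (card ?E) * ennreal t"
      using f0 by (intro sum_bounded_above) (auto intro: ennreal_leI)
    also have "\<dots> = ennreal (real (card ?E) * t)"
      using \<open>0 \<le> t\<close> by (simp add: ennreal_of_nat_eq_real_of_nat ennreal_mult)
    also have "\<dots> \<le> ennreal (real (card J) * t)"
      by (rule agreeing[OF Output])
    finally show ?case
      using told_apart[OF Output, of "\<lambda>i. ennreal (f i x)" x] M
      by (simp add: nn_value_simps oracle_calls_simps split[OF Output, of _ "\<lambda>i. f i x = f0 x"]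
          add_mono ennreal_leI)
  next
    case (Query x k)
    let ?E = "{i\<in>J. f i x = f0 x}"
    have "(\<Sum>i\<in>?E. nn_value (f i) (k (f i x))) = (\<Sum>i\<in>?E. nn_value (f i) (k (f0 x)))"
      by (intro sum.cong) auto
    also have "\<dots> \<le> ennreal (real (card ?E) * t)
        + ennreal (M * R) * (oracle_calls f0 (k (f0 x)) + 1)"
      using Query.prems by (intro Query.IH) auto
    also have "\<dots> \<le> ennreal (real (card J) * t)
        + ennreal (M * R) * (oracle_calls f0 (k (f0 x)) + 1)"
      by (intro add_right_mono agreeing[OF Query.prems])
    finally have agree: "(\<Sum>i\<in>?E. nn_value (f i) (k (f i x))) \<le> ennreal (real (card J) * t)
        + ennreal (M * R) * (oracle_calls f0 (k (f0 x)) + 1)" .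
    have "(\<Sum>i\<in>{i\<in>J. f i x \<noteq> f0 x}. nn_value (f i) (k (f i x))) \<le> ennreal (M * R)"
      by (rule told_apart[OF Query.prems]) (rule nn_value_le, rule M)
    with agree have "(\<Sum>i\<in>J. nn_value (f i) (k (f i x))) \<le>
        (ennreal (real (card J) * t) + ennreal (M * R) * (oracle_calls f0 (k (f0 x)) + 1))
        + ennreal (M * R)"
      unfolding split[OF Query.prems, of _ "\<lambda>i. f i x = f0 x"]
      by (rule add_mono)
    then show ?case
      by (simp add: nn_value_simps oracle_calls_simps distrib_left add_ac)
  next
    case (Choose p)
    have "(\<Sum>i\<in>J. nn_value (f i) (Choose p)) = (\<integral>\<^sup>+ A. (\<Sum>i\<in>J. nn_value (f i) A) \<partial>measure_pmf p)"
      by (simp add: nn_value_simps nn_integral_sum)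
    also have "\<dots> \<le> (\<integral>\<^sup>+ A. ennreal (real (card J) * t) + ennreal (M * R) * (oracle_calls f0 A + 1) \<partial>measure_pmf p)"
      using Choose by (intro nn_integral_mono_AE AE_pmfI) auto
    also have "\<dots> = ennreal (real (card J) * t) + ennreal (M * R) * (oracle_calls f0 (Choose p) + 1)"
      by (simp add: nn_integral_add nn_integral_cmult oracle_calls_simps)
    finally show ?case .
  qed
qed

definition small_sets :: "'a set \<Rightarrow> nat \<Rightarrow> 'a set set" where
  "small_sets V t = {X. X \<subseteq> V \<and> card X \<le> t}"

lemma small_sets_subset:
  assumes "finite V" "Y \<in> small_sets V t" "X \<subseteq> Y"
  shows "X \<in> small_sets V t"
  using assms card_mono[of Y X] finite_subset[of Y V] by (auto simp: small_sets_def)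

lemma xos_on_small_sets:
  assumes "finite V"
  shows "xos_on V (downset_card (small_sets V t))"
  using assms
  by (intro xos_on_downset_card) (auto simp: small_sets_def dest: small_sets_subset)

lemma card_colourings_containing:
  fixes V :: "'a set" and b :: nat
  assumes "finite V" "X \<subseteq> V" "0 < b"
  shows "card {h \<in> V \<rightarrow>\<^sub>E {..<b}. X \<subseteq> {v\<in>V. h v = 0}} = b ^ (card V - card X)"
proof -
  have "{h \<in> V \<rightarrow>\<^sub>E {..<b}. X \<subseteq> {v\<in>V. h v = 0}} = (\<Pi>\<^sub>E v\<in>V. if v \<in> X then {0} else {..<b})"
    using assms by (auto simp: PiE_iff extensional_def split: if_splits)
  moreover have "card (\<Pi>\<^sub>E v\<in>V. if v \<in> X then {0} else {..<b}) = (\<Prod>v\<in>V. if v \<in> X then 1 else b)"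
    using assms by (simp add: card_PiE if_distrib cong: if_cong)
  moreover have "(\<Prod>v\<in>V. if v \<in> X then 1 else b) = b ^ card (V - X)"
    using assms by (simp add: prod.If_cases Diff_eq)
  ultimately show ?thesis
    using assms by (simp add: card_Diff_subset finite_subset)
qed

lemma sum_card_colour_class:
  fixes V :: "'a set" and b :: nat
  assumes "finite V" "0 < b"
  shows "(\<Sum>h \<in> V \<rightarrow>\<^sub>E {..<b}. card {v\<in>V. h v = 0}) = card V * b ^ (card V - 1)"
proof -
  let ?I = "V \<rightarrow>\<^sub>E {..<b}"
  have finI: "finite ?I"
    using assms by (intro finite_PiE) auto
  have "(\<Sum>h\<in>?I. card {v\<in>V. h v = 0}) = (\<Sum>h\<in>?I. \<Sum>v\<in>V. of_bool (h v = 0))"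
    using assms by (simp add: sum.If_cases of_bool_def Int_def)
  also have "\<dots> = (\<Sum>v\<in>V. \<Sum>h\<in>?I. of_bool (h v = 0))"
    by (rule sum.swap)
  also have "\<dots> = (\<Sum>v\<in>V. card {h\<in>?I. {v} \<subseteq> {v\<in>V. h v = 0}})"
    using finI by (intro sum.cong) (auto simp: sum.If_cases of_bool_def Int_def)
  also have "\<dots> = (\<Sum>v\<in>V. b ^ (card V - 1))"
  proof (rule sum.cong)
    fix v assume "v \<in> V"
    then show "card {h\<in>?I. {v} \<subseteq> {v\<in>V. h v = 0}} = b ^ (card V - 1)"
      using assms card_colourings_containing[of V "{v}" b] by simp
  qed simp
  finally show ?thesis by simp
qed

lemma oracle_calls_small_sets_ge:
  fixes V :: "'a set" and b t :: nat
  assumes V: "finite V" and b: "0 < b" and size: "\<alpha> * real b * (real t + 1) \<le> real (card V)"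
    and A: "xos_approx_alg V \<alpha> A"
  shows "ennreal (real b ^ (t + 1) / real (card V))
    \<le> oracle_calls (downset_card (small_sets V t)) A + 1"
proof -
  define n where "n = card V"
  define I where "I = V \<rightarrow>\<^sub>E {..<b}"
  define S where "S h = {v\<in>V. h v = 0}" for h :: "'a \<Rightarrow> nat"
  define f0 where "f0 = downset_card (small_sets V t)"
  define f where "f h = downset_card (small_sets V t \<union> Pow (S h))" for h
  define R where "R = real b ^ n / real b ^ (t + 1)"
  define Q where "Q = oracle_calls f0 A + 1"
  have alpha: "1 \<le> \<alpha>"
    using A by (simp add: xos_approx_alg_def)
  have "0 < \<alpha> * real b * (real t + 1)"
    using alpha b by simp
  then have n: "0 < n"
    using size unfolding n_def by linarith
  have I: "finite I" "card I = b ^ n"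
    using V by (auto simp: I_def n_def card_PiE intro!: finite_PiE)
  have xos: "xos_on V (f h)" for h
    unfolding f_def using V
    by (intro xos_on_downset_card) (auto simp: small_sets_def S_def dest: small_sets_subset)
  have f_le: "f h X \<le> real n" for h X
    using V by (auto simp: f_def downset_card_def small_sets_def S_def n_def intro!: card_mono)
  have apart: "real (card {h\<in>I. f h X \<noteq> f0 X}) \<le> R" for X
  proof (cases "X \<subseteq> V \<and> t < card X")
    case True
    have "{h\<in>I. f h X \<noteq> f0 X} \<subseteq> {h\<in>I. X \<subseteq> S h}"
      by (auto simp: f_def f0_def downset_card_def split: if_splits)
    then have "card {h\<in>I. f h X \<noteq> f0 X} \<le> card {h\<in>I. X \<subseteq> S h}"
      using I by (intro card_mono) auto
    also have "\<dots> = b ^ (n - card X)"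
      using card_colourings_containing[of V X b] V b True by (simp add: I_def S_def n_def)
    also have "\<dots> \<le> b ^ (n - (t + 1))"
      using True b by (intro power_increasing) auto
    finally have "real (card {h\<in>I. f h X \<noteq> f0 X}) \<le> real b ^ (n - (t + 1))"
      by (metis of_nat_le_iff of_nat_power)
    moreover have "t + 1 \<le> n"
      using True V card_mono[of V X] by (simp add: n_def)
    ultimately show ?thesis
      using b by (simp add: R_def power_diff)
  next
    case False
    then have "{h\<in>I. f h X \<noteq> f0 X} = {}"
      by (auto simp: f_def f0_def downset_card_def small_sets_def S_def split: if_splits)
    then show ?thesis
      by (simp only: card.empty R_def) simp
  qed
  have good: "real (card (S h)) / \<alpha> \<le> expected_value (f h) A" for h
  proof -
    have "real (card (S h)) = f h (S h)"
      by (simp add: f_def downset_card_def)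
    also have "\<dots> \<le> Max (f h ` Pow V)"
      using V by (intro Max_ge) (auto simp: S_def)
    finally show ?thesis
      using A xos[of h] alpha by (simp add: xos_approx_alg_def field_simps) (smt (verit) mult.commute)
  qed
  have "ennreal (real n * real b ^ (n - 1) / \<alpha>) = ennreal (\<Sum>h\<in>I. real (card (S h)) / \<alpha>)"
    using sum_card_colour_class[OF V b]
    by (simp flip: sum_divide_distrib of_nat_sum of_nat_power of_nat_mult add: I_def S_def n_def)
  also have "\<dots> = (\<Sum>h\<in>I. ennreal (real (card (S h)) / \<alpha>))"
    using alpha by (intro sum_ennreal[symmetric]) simp
  also have "\<dots> \<le> (\<Sum>h\<in>I. nn_value (f h) A)"
  proof (rule sum_mono)
    fix h
    have "ennreal (expected_value (f h) A) \<le> nn_value (f h) A"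
      by (rule expected_value_le_nn_value) (simp add: f_def downset_card_nonneg)
    then show "ennreal (real (card (S h)) / \<alpha>) \<le> nn_value (f h) A"
      using good[of h] ennreal_leI order_trans by blast
  qed
  also have "\<dots> \<le> ennreal (real (card I) * real t) + ennreal (real n * R) * Q"
    unfolding Q_def
    by (rule sum_nn_value_le[OF I(1) _ f_le apart])
      (auto simp: f0_def downset_card_def small_sets_def)
  finally have main: "ennreal (real n * real b ^ (n - 1) / \<alpha>)
      \<le> ennreal (real b ^ n * real t) + ennreal (real n * R) * Q"
    using I(2) by simp
  have "ennreal (real b ^ (t + 1) / real n) \<le> Q"
  proof (cases Q rule: ennreal_cases)
    case (real q)
    have "R \<ge> 0" by (simp add: R_def)
    then have "real n * real b ^ (n - 1) / \<alpha> \<le> real b ^ n * real t + real n * R * q"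
      using main real by (simp flip: ennreal_mult ennreal_plus)
    moreover have "real b ^ n * (real t + 1) \<le> real n * real b ^ (n - 1) / \<alpha>"
    proof -
      have "real b ^ n * (real t + 1) * \<alpha> = (\<alpha> * real b * (real t + 1)) * real b ^ (n - 1)"
        using n by (cases n) simp_all
      also have "\<dots> \<le> real n * real b ^ (n - 1)"
        using size by (intro mult_right_mono) (simp_all add: n_def)
      finally show ?thesis
        using alpha by (simp add: pos_le_divide_eq)
    qed
    ultimately have "real b ^ n \<le> real n * R * q"
      by (simp add: distrib_left)
    then have "real b ^ (t + 1) / real n \<le> q"
      using b n by (simp add: R_def field_simps)
    then show ?thesis
      using real by (simp add: ennreal_leI)
  qed simp
  then show ?thesis
    by (simp add: Q_def f0_def n_def)
qed

lemma many_calls_small_sets: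
  fixes V :: "'a set" and b t :: nat
  assumes "finite V" "0 < b" "\<alpha> * real b * (real t + 1) \<le> real (card V)"
    and "xos_approx_alg V \<alpha> A"
    and "0 \<le> N" "N + 1 \<le> real b ^ (t + 1) / real (card V)"
  shows "many_calls (return_pmf (downset_card (small_sets V t))) A N"
proof -
  let ?Q = "oracle_calls (downset_card (small_sets V t)) A"
  have "ennreal (N + 1) \<le> ?Q + 1"
    using oracle_calls_small_sets_ge[OF assms(1-4)] ennreal_leI[OF assms(6)] order_trans by blast
  then have "1 + ennreal N \<le> 1 + ?Q"
    using \<open>0 \<le> N\<close> by (simp add: ennreal_plus add.commute)
  then have N: "ennreal N \<le> ?Q"
    by (simp add: ennreal_add_left_cancel_le)
  have "ennreal (\<delta> * N) \<le> ?Q" if "\<delta> < 1" for \<delta>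
  proof -
    have "\<delta> * N \<le> N"
      using that \<open>0 \<le> N\<close> mult_right_mono[of \<delta> 1 N] by simp
    then show ?thesis
      using N ennreal_leI order_trans by blast
  qed
  then show ?thesis
    by (auto simp: many_calls_def)
qed

definition point_instance :: "(nat \<Rightarrow> nat) \<Rightarrow> nat \<Rightarrow> (nat set \<Rightarrow> real) pmf" where
  "point_instance t n = return_pmf (downset_card (small_sets {..<n} (t n)))"

lemma xos_distribution_point_instance: "xos_distribution (point_instance t)"
  by (simp add: xos_distribution_def point_instance_def xos_on_small_sets)

lemma polynomial_ratio:
  fixes \<epsilon> :: real
  assumes "0 < \<epsilon>"
  defines "t \<equiv> \<lambda>n. nat \<lfloor>real n powr (\<epsilon> / 2)\<rfloor>"
  shows "\<forall>\<^sub>F n in sequentially. \<forall>A. xos_approx_alg {..<n} (real n powr (1 - \<epsilon>)) A \<longrightarrow>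
    many_calls (point_instance t n) A (2 powr (1 / 2 * real n powr (\<epsilon> / 2)))"
proof -
  have "\<forall>\<^sub>F n in sequentially. real n powr (1 - \<epsilon>) * 2 * (real n powr (\<epsilon> / 2) + 1) \<le> real n"
    using assms(1) by real_asymp
  moreover have "\<forall>\<^sub>F n in sequentially. 2 powr (1 / 2 * real n powr (\<epsilon> / 2)) + 1
      \<le> 2 powr (real n powr (\<epsilon> / 2)) / real n"
    using assms(1) by real_asymp
  ultimately show ?thesis
  proof eventually_elim
    case (elim n)
    let ?s = "real n powr (\<epsilon> / 2)"
    have t: "real (t n) \<le> ?s" "?s \<le> real (t n + 1)"
      unfolding t_def by (simp_all, linarith)
    have "real n powr (1 - \<epsilon>) * 2 * (real (t n) + 1) \<le> real n powr (1 - \<epsilon>) * 2 * (?s + 1)"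
      using t by (intro mult_left_mono) auto
    then have size: "real n powr (1 - \<epsilon>) * real 2 * (real (t n) + 1) \<le> real (card {..<n})"
      using elim(1) by (simp only: card_lessThan of_nat_numeral)
    have "2 powr ?s \<le> 2 powr real (t n + 1)"
      using t(2) by (intro powr_mono) auto
    also have "\<dots> = real 2 ^ (t n + 1)"
      by (subst powr_realpow) auto
    finally have "2 powr ?s / real n \<le> real 2 ^ (t n + 1) / real n"
      by (intro divide_right_mono) auto
    then have "2 powr (1 / 2 * ?s) + 1 \<le> real 2 ^ (t n + 1) / real (card {..<n})"
      using elim(2) by simp
    then show ?case
      unfolding point_instance_def using size
      by (intro allI impI many_calls_small_sets[where b = 2]) auto
  qed
qed

lemma logarithmic_ratio:
  fixes \<alpha> :: "nat \<Rightarrow> real"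
  assumes \<alpha>: "\<alpha> \<in> o(\<lambda>n. real n / ln (real n))"
  defines "t \<equiv> \<lambda>n. nat \<lfloor>ln (real n)\<rfloor>"
  shows "\<exists>g :: nat \<Rightarrow> real. filterlim g at_top sequentially \<and>
    (\<forall>\<^sub>F n in sequentially. \<forall>A. xos_approx_alg {..<n} (\<alpha> n) A \<longrightarrow>
      many_calls (point_instance t n) A (real n powr g n))"
proof -
  define K where "K n = real n / (max 1 (\<alpha> n) * (ln (real n) + 1))" for n
  define b where "b n = nat \<lfloor>K n\<rfloor>" for n
  define g where "g n = ln (real (b n)) - 2" for n
  have K: "filterlim K at_top sequentially"
    unfolding filterlim_at_top_gt[where c = 0]
  proof (intro allI impI)
    fix Z :: real assume Z: "0 < Z"
    have "\<forall>\<^sub>F n in sequentially. norm (\<alpha> n) \<le> 1 / (2 * Z) * norm (real n / ln (real n))"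
      using Z by (intro landau_o.smallD[OF \<alpha>]) auto
    moreover have "\<forall>\<^sub>F n in sequentially. 1 \<le> 1 / (2 * Z) * (real n / ln (real n))"
      using Z by real_asymp
    moreover have "\<forall>\<^sub>F n in sequentially. 1 \<le> ln (real n)"
      by real_asymp
    ultimately show "\<forall>\<^sub>F n in sequentially. Z \<le> K n"
    proof eventually_elim
      case (elim n)
      have "max 1 (\<alpha> n) \<le> 1 / (2 * Z) * (real n / ln (real n))"
        using elim by auto
      then have "max 1 (\<alpha> n) * (ln (real n) + 1)
          \<le> (1 / (2 * Z) * (real n / ln (real n))) * (2 * ln (real n))"
        using elim Z by (intro mult_mono) auto
      also have "\<dots> = real n / Z"
        using elim by (simp add: field_simps)
      finally show ?case
        using Z elim(3) by (simp add: K_def pos_le_divide_eq mult.commute)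
    qed
  qed
  have g: "filterlim g at_top sequentially"
  proof -
    have "filterlim (\<lambda>x::real. ln (real (nat \<lfloor>x\<rfloor>)) - 2) at_top at_top"
      by real_asymp
    then show ?thesis
      unfolding g_def b_def using K by (rule filterlim_compose)
  qed
  have "\<forall>\<^sub>F n in sequentially. 1 \<le> K n" "\<forall>\<^sub>F n in sequentially. 0 \<le> g n"
    using K g by (auto simp: filterlim_at_top)
  then have "\<forall>\<^sub>F n in sequentially. \<forall>A. xos_approx_alg {..<n} (\<alpha> n) A \<longrightarrow>
      many_calls (point_instance t n) A (real n powr g n)"
    using eventually_ge_at_top[of "2::nat"]
  proof eventually_elim
    case (elim n)
    have ln: "0 \<le> ln (real n)"
      using elim(3) by simp
    have t: "real (t n) \<le> ln (real n)" "ln (real n) \<le> real (t n + 1)"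
      using ln unfolding t_def by (simp_all, linarith)
    have b: "0 < b n" "real (b n) \<le> K n"
      using elim(1) by (simp_all add: b_def)
    show ?case
    proof (intro allI impI)
      fix A assume A: "xos_approx_alg {..<n} (\<alpha> n) A"
      then have "1 \<le> \<alpha> n"
        by (simp add: xos_approx_alg_def)
      then have "\<alpha> n * real (b n) * (real (t n) + 1) \<le> \<alpha> n * K n * (ln (real n) + 1)"
        using t b by (intro mult_mono) auto
      also have "\<dots> = real n"
      proof -
        have "\<alpha> n \<noteq> 0" "ln (real n) + 1 \<noteq> 0"
          using \<open>1 \<le> \<alpha> n\<close> ln by auto
        then show ?thesis
          using \<open>1 \<le> \<alpha> n\<close> by (simp add: K_def)
      qed
      finally have size: "\<alpha> n * real (b n) * (real (t n) + 1) \<le> real (card {..<n})"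
        by simp
      have "1 \<le> real n powr g n"
        using elim by (intro ge_one_powr_ge_zero) auto
      moreover have "real n powr g n * 2 \<le> real n powr g n * real n"
        using elim(3) by (intro mult_left_mono) auto
      ultimately have "real n powr g n + 1 \<le> real n powr g n * real n"
        by linarith
      also have "\<dots> = real n powr (g n + 1)"
        using elim(3) by (simp add: powr_add)
      also have "\<dots> = real n powr ln (real (b n)) / real n"
        using elim(3) by (simp add: g_def powr_diff power2_eq_square powr_add)
      also have "real n powr ln (real (b n)) = real (b n) powr ln (real n)"
        using elim(3) b by (simp add: powr_def mult.commute)
      also have "\<dots> \<le> real (b n) powr real (t n + 1)"
        using t b by (intro powr_mono) auto
      also have "\<dots> = real (b n) ^ (t n + 1)"
        using b by (subst powr_realpow) auto
      finally have "real n powr g n + 1 \<le> real (b n) ^ (t n + 1) / real (card {..<n})"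
        by (simp add: divide_right_mono)
      then show "many_calls (point_instance t n) A (real n powr g n)"
        unfolding point_instance_def using A b size by (intro many_calls_small_sets) auto
    qed
  qed
  then show ?thesis
    using g by blast
qed

theorem theorem3:
  "(\<forall>\<epsilon>::real. \<epsilon> > 0 \<longrightarrow>
      (\<exists>(c::real) D. c > 0 \<and> xos_distribution D \<and>
        (\<exists>C::real. C > 0 \<and>
          (\<forall>\<^sub>F n in sequentially. \<forall>A.
             xos_approx_alg {..<n} (real n powr (1 - \<epsilon>)) A \<longrightarrow>
             many_calls (D n) A (2 powr (C * real n powr c))))))
   \<and>
   (\<exists>D. xos_distribution D \<and>
      (\<forall>\<alpha> :: nat \<Rightarrow> real. \<alpha> \<in> o(\<lambda>n. real n / ln (real n)) \<longrightarrow>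
        (\<exists>g :: nat \<Rightarrow> real. filterlim g at_top sequentially \<and>
          (\<forall>\<^sub>F n in sequentially. \<forall>A.
             xos_approx_alg {..<n} (\<alpha> n) A \<longrightarrow>
             many_calls (D n) A (real n powr g n)))))"
proof (intro conjI allI impI)
  fix \<epsilon> :: real assume \<epsilon>: "\<epsilon> > 0"
  show "\<exists>(c::real) D. c > 0 \<and> xos_distribution D \<and>
        (\<exists>C::real. C > 0 \<and>
          (\<forall>\<^sub>F n in sequentially. \<forall>A.
             xos_approx_alg {..<n} (real n powr (1 - \<epsilon>)) A \<longrightarrow>
             many_calls (D n) A (2 powr (C * real n powr c))))"
    using \<epsilon> polynomial_ratio[OF \<epsilon>] xos_distribution_point_instance
    by (intro exI[of _ "\<epsilon> / 2"] exI conjI exI[of _ "1 / 2 :: real"]) auto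
next
  show "\<exists>D. xos_distribution D \<and>
      (\<forall>\<alpha> :: nat \<Rightarrow> real. \<alpha> \<in> o(\<lambda>n. real n / ln (real n)) \<longrightarrow>
        (\<exists>g :: nat \<Rightarrow> real. filterlim g at_top sequentially \<and>
          (\<forall>\<^sub>F n in sequentially. \<forall>A.
             xos_approx_alg {..<n} (\<alpha> n) A \<longrightarrow>
             many_calls (D n) A (real n powr g n))))"
    using logarithmic_ratio xos_distribution_point_instance by blast
qed

end
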